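(* Let $\lambda$ be a nonzero real number. Define the degenerate B-algorithm matrix $(a_{n,m}(\lambda))_{n,m\ge0}$ by $a_{0,0}(\lambda)=0$, $a_{0,m}(\lambda)=\frac{(-1)^m}{m!}$ for $m\ge1$, and \[ a_{n,m}(\lambda)=\big(m-(n-1)\lambda\big)a_{n-1,m}(\lambda)-(m+1)a_{n-1,m+1}(\lambda),\qquad n\ge1,\ m\ge0. \] Then for every $n\ge1$, \[ a_{n,0}(\lambda)=\sum_{k=1}^{n}{n \brace k}_{\lambda}=\phi_{n,\lambda}. \]
   Context: For $n\ge0$ set $(x)_{0,\lambda}=1$, $(x)_{n,\lambda}=x(x-\lambda)\cdots(x-(n-1)\lambda)$ for $n\ge1$, and $(x)_0=1$, $(x)_n=x(x-1)\cdots(x-n+1)$ for $n\ge1$. The degenerate Stirling numbers of the second kind ${n \brace k}_{\lambda}$ are defined by $(x)_{n,\lambda}=\sum_{k=0}^{n}{n \brace k}_{\lambda}(x)_{k}$. The degenerate Bell numbers are $\phi_{n,\lambda}=\sum_{k=0}^{n}{n \brace k}_{\lambda}$; equivalently $e^{e_\lambda(t)-1}=\sum_{n\ge0}\phi_{n,\lambda}\frac{t^n}{n!}$, where $e_\lambda(t)=(1+\lambda t)^{1/\lambda}=\sum_{k\ge0}(1)_{k,\lambda}\frac{t^k}{k!}$. *)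

theory Defs
  imports Complex_Main
begin

definition ffact :: "real \<Rightarrow> nat \<Rightarrow> real" where
  "ffact x n = (\<Prod>i<n. x - real i)"

definition degen_ffact :: "real \<Rightarrow> real \<Rightarrow> nat \<Rightarrow> real" where
  "degen_ffact l x n = (\<Prod>i<n. x - real i * l)"

text \<open>
  The coefficient sequence of \<open>(x)\<^bsub>n,l\<^esub>\<close> in the basis of falling factorials, extended by \<open>0\<close>
  beyond \<open>n\<close> so that it is unique as a function on all of \<open>nat\<close>;
  \<open>degen_stirling2_ex1\<close> shows that the description is proper.
\<close>

definition degen_stirling2 :: "real \<Rightarrow> nat \<Rightarrow> nat \<Rightarrow> real" where
  "degen_stirling2 l n =
     (THE c. (\<forall>x. degen_ffact l x n = (\<Sum>k=0..n. c k * ffact x k)) \<and> (\<forall>k>n. c k = 0))"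

definition degen_bell :: "real \<Rightarrow> nat \<Rightarrow> real" where
  "degen_bell l n = (\<Sum>k=0..n. degen_stirling2 l n k)"

fun degen_B_matrix :: "real \<Rightarrow> nat \<Rightarrow> nat \<Rightarrow> real" where
  "degen_B_matrix l 0 m = (if m = 0 then 0 else (-1) ^ m / fact m)"
| "degen_B_matrix l (Suc n) m =
     (real m - real n * l) * degen_B_matrix l n m
     - (real m + 1) * degen_B_matrix l n (m + 1)"

lemma ffact_coeffs_unique:
  assumes "\<And>x. (\<Sum>k=0..n. c k * ffact x k) = (\<Sum>k=0..n. d k * ffact x k)" and "k \<le> n"
  shows "c k = d k"
  using assms(2)
proof (induction k rule: less_induct)
  case (less k)
  have z: "ffact (real k) j = 0" if "j > k" for j
    unfolding ffact_def using that by (intro prod_zero) auto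
  have nz: "ffact (real k) k \<noteq> 0"
    unfolding ffact_def by auto
  have *: "(\<Sum>j=0..n. e j * ffact (real k) j)
      = (\<Sum>j<k. e j * ffact (real k) j) + e k * ffact (real k) k" for e :: "nat \<Rightarrow> real"
  proof -
    have "(\<Sum>j=0..n. e j * ffact (real k) j) = (\<Sum>j\<in>{..<Suc k}. e j * ffact (real k) j)"
      using less.prems z by (intro sum.mono_neutral_right) auto
    then show ?thesis by simp
  qed
  have "(\<Sum>j<k. c j * ffact (real k) j) = (\<Sum>j<k. d j * ffact (real k) j)"
    using less by (intro sum.cong) auto
  then show ?case
    using assms(1)[of "real k"] nz unfolding * by simp
qed

lemma degen_ffact_expansion:
  "\<exists>c. (\<forall>x. degen_ffact l x n = (\<Sum>k=0..n. c k * ffact x k)) \<and> (\<forall>k>n. c k = 0)"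
proof (induction n)
  case 0
  show ?case
    by (rule exI[of _ "\<lambda>k. if k = 0 then 1 else 0"]) (simp add: degen_ffact_def ffact_def)
next
  case (Suc n)
  then obtain c where c: "\<And>x. degen_ffact l x n = (\<Sum>k=0..n. c k * ffact x k)"
    and c0: "\<And>k. k > n \<Longrightarrow> c k = 0" by blast
  define d where "d k = (if k = 0 then 0 else c (k - 1)) + (real k - real n * l) * c k" for k
  have "degen_ffact l x (Suc n) = (\<Sum>k=0..Suc n. d k * ffact x k)" for x
  proof -
    have step: "ffact x (Suc k) = (x - real k) * ffact x k" for k
      by (simp add: ffact_def)
    have "degen_ffact l x (Suc n) = (x - real n * l) * (\<Sum>k=0..n. c k * ffact x k)"
      unfolding c[symmetric] by (simp add: degen_ffact_def)
    also have "\<dots> = (\<Sum>k=0..n. c k * ffact x (Suc k))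
        + (\<Sum>k=0..n. (real k - real n * l) * c k * ffact x k)"
      unfolding sum_distrib_left sum.distrib[symmetric]
      by (intro sum.cong) (auto simp: step algebra_simps)
    also have "(\<Sum>k=0..n. c k * ffact x (Suc k))
        = (\<Sum>k=0..Suc n. (if k = 0 then 0 else c (k - 1)) * ffact x k)"
      by (subst sum.atLeast0_atMost_Suc_shift) simp
    also have "(\<Sum>k=0..n. (real k - real n * l) * c k * ffact x k)
        = (\<Sum>k=0..Suc n. (real k - real n * l) * c k * ffact x k)"
      by (simp add: c0)
    finally show ?thesis
      unfolding d_def sum.distrib[symmetric] by (simp only: distrib_right)
  qed
  moreover have "\<forall>k>Suc n. d k = 0" by (auto simp: d_def c0)
  ultimately show ?case by blast
qed

lemma degen_stirling2_ex1:
  "\<exists>!c. (\<forall>x. degen_ffact l x n = (\<Sum>k=0..n. c k * ffact x k)) \<and> (\<forall>k>n. c k = 0)"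
proof (rule ex_ex1I[OF degen_ffact_expansion])
  fix c d :: "nat \<Rightarrow> real"
  assume c: "(\<forall>x. degen_ffact l x n = (\<Sum>k=0..n. c k * ffact x k)) \<and> (\<forall>k>n. c k = 0)"
    and d: "(\<forall>x. degen_ffact l x n = (\<Sum>k=0..n. d k * ffact x k)) \<and> (\<forall>k>n. d k = 0)"
  show "c = d"
  proof
    fix k
    show "c k = d k"
    proof (cases "k \<le> n")
      case True
      show ?thesis by (rule ffact_coeffs_unique[OF _ True]) (use c d in metis)
    next
      case False
      with c d show ?thesis by simp
    qed
  qed
qed

lemma degen_ffact_eq_sum_degen_stirling2:
  "degen_ffact l x n = (\<Sum>k=0..n. degen_stirling2 l n k * ffact x k)"
  using theI'[OF degen_stirling2_ex1[of l n]] unfolding degen_stirling2_def by blast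

end

(* With T the operator (T b) m = m * b m - (m + 1) * b (m + 1) on sequences, row n of the matrix is
   (T)_{n,l} applied to row 0, i.e. the sum of the {n, k}_l * (T)_k applied to row 0. On generating
   functions T is (x - 1) D, hence (T)_k = (x - 1)^k D^k, and row 0 is exp(-x) - 1, so that
   (T)_k maps row 0 to (1 - x)^k exp(-x) for k >= 1, whose constant coefficient is 1. *)
theory Submission
  imports Defs
begin

lemma degen_stirling2_eq_0: "k > n \<Longrightarrow> degen_stirling2 l n k = 0"
  using theI'[OF degen_stirling2_ex1[of l n]] unfolding degen_stirling2_def by blast

lemma degen_stirling2_eqI:
  assumes "\<And>x. degen_ffact l x n = (\<Sum>k=0..n. c k * ffact x k)" and "\<And>k. k > n \<Longrightarrow> c k = 0"
  shows "degen_stirling2 l n = c"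
  unfolding degen_stirling2_def
  by (rule the1_equality[OF degen_stirling2_ex1]) (use assms in blast)

lemma degen_stirling2_0: "degen_stirling2 l 0 = (\<lambda>k. if k = 0 then 1 else 0)"
  by (rule degen_stirling2_eqI) (simp_all add: degen_ffact_def ffact_def)

text \<open>Multiply the expansion of \<open>degen_ffact l x n\<close> by x - n*l and split this
  factor as (x - k) + (k - n*l) in the k-th term; (x - k) raises \<open>ffact x k\<close> to the
  next falling factorial.\<close>

lemma degen_stirling2_Suc:
  "degen_stirling2 l (Suc n) = (\<lambda>k. (if k = 0 then 0 else degen_stirling2 l n (k - 1))
     + (real k - real n * l) * degen_stirling2 l n k)"
proof (rule degen_stirling2_eqI)
  fix x
  let ?S = "degen_stirling2 l n"
  have step: "ffact x (Suc k) = (x - real k) * ffact x k" for k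
    by (simp add: ffact_def)
  have "degen_ffact l x (Suc n) = (x - real n * l) * (\<Sum>k=0..n. ?S k * ffact x k)"
    unfolding degen_ffact_eq_sum_degen_stirling2[symmetric] by (simp add: degen_ffact_def)
  also have "\<dots> = (\<Sum>k=0..n. ?S k * ffact x (Suc k))
      + (\<Sum>k=0..n. (real k - real n * l) * ?S k * ffact x k)"
    unfolding sum_distrib_left sum.distrib[symmetric]
    by (intro sum.cong) (auto simp: step algebra_simps)
  also have "(\<Sum>k=0..n. ?S k * ffact x (Suc k))
      = (\<Sum>k=0..Suc n. (if k = 0 then 0 else ?S (k - 1)) * ffact x k)"
    by (subst sum.atLeast0_atMost_Suc_shift) simp
  also have "(\<Sum>k=0..n. (real k - real n * l) * ?S k * ffact x k)
      = (\<Sum>k=0..Suc n. (real k - real n * l) * ?S k * ffact x k)"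
    by (simp add: degen_stirling2_eq_0)
  finally show "degen_ffact l x (Suc n) = (\<Sum>k=0..Suc n. ((if k = 0 then 0 else ?S (k - 1))
      + (real k - real n * l) * ?S k) * ffact x k)"
    unfolding sum.distrib[symmetric] by (simp only: distrib_right)
qed (auto simp: degen_stirling2_eq_0)

lemma degen_stirling2_right_0:
  assumes "n \<ge> 1"
  shows "degen_stirling2 l n 0 = 0"
  using assms
proof (induction n rule: nat_induct_at_least)
  case base
  show ?case using degen_stirling2_Suc[of l 0] by simp
qed (simp add: degen_stirling2_Suc)

text \<open>For \<open>l = 1\<close> the rows are the sequences \<open>(T)\<^sub>k\<close> applied to row \<open>0\<close>.\<close>

lemma degen_B_matrix_eq_sum:
  "degen_B_matrix l n m = (\<Sum>k=0..n. degen_stirling2 l n k * degen_B_matrix 1 k m)"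
proof (induction n arbitrary: m)
  case 0
  show ?case by (simp add: degen_stirling2_0)
next
  case (Suc n)
  let ?S = "degen_stirling2 l n" and ?B = "degen_B_matrix 1"
  have "degen_B_matrix l (Suc n) m
      = (\<Sum>k=0..n. ?S k * ((real m - real n * l) * ?B k m - (real m + 1) * ?B k (m + 1)))"
    by (simp add: Suc.IH sum_distrib_left sum_subtractf[symmetric] algebra_simps)
  \<comment> \<open>Same splitting as for the Stirling numbers: m - n*l = (m - k) + (k - n*l), where
    the part with m - k completes row k + 1 of the matrix for \<open>l = 1\<close>.\<close>
  also have "\<dots> = (\<Sum>k=0..n. ?S k * ?B (Suc k) m)
      + (\<Sum>k=0..n. (real k - real n * l) * ?S k * ?B k m)"
    unfolding sum.distrib[symmetric] by (intro sum.cong) (auto simp: algebra_simps)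
  also have "(\<Sum>k=0..n. ?S k * ?B (Suc k) m)
      = (\<Sum>k=0..Suc n. (if k = 0 then 0 else ?S (k - 1)) * ?B k m)"
    by (subst sum.atLeast0_atMost_Suc_shift) simp
  also have "(\<Sum>k=0..n. (real k - real n * l) * ?S k * ?B k m)
      = (\<Sum>k=0..Suc n. (real k - real n * l) * ?S k * ?B k m)"
    by (simp add: degen_stirling2_eq_0)
  finally show ?case
    unfolding degen_stirling2_Suc sum.distrib[symmetric] by (simp only: distrib_right)
qed

text \<open>The coefficient of \<open>x\<^sup>m\<close> in \<open>(1 - x)\<^sup>k exp (- x)\<close>.\<close>

fun pow_exp_coeff :: "nat \<Rightarrow> nat \<Rightarrow> real" where
  "pow_exp_coeff 0 m = (-1) ^ m / fact m"
| "pow_exp_coeff (Suc k) m = pow_exp_coeff k m - (if m = 0 then 0 else pow_exp_coeff k (m - 1))"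

lemma pow_exp_coeff_right_0: "pow_exp_coeff k 0 = 1"
  by (induction k) auto

text \<open>Coefficient form of (x - 1) D f - k f = (1 - x) f for f = (1 - x)^k exp(-x).\<close>

lemma pow_exp_coeff_Suc_eq:
  "pow_exp_coeff (Suc k) m
     = (real m - real k) * pow_exp_coeff k m - (real m + 1) * pow_exp_coeff k (m + 1)"
proof (induction k arbitrary: m)
  case 0
  \<comment> \<open>This is D exp(-x) = -exp(-x), read off at x^j.\<close>
  have step: "(real j + 1) * pow_exp_coeff 0 (Suc j) = - pow_exp_coeff 0 j" for j
    by (simp add: field_simps del: of_nat_Suc) (simp add: algebra_simps)
  show ?case
    using step[of m] step[of "m - 1"] by (cases m) (simp_all add: add.commute)
next
  case (Suc k)
  have "pow_exp_coeff (Suc (Suc k)) m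
      = pow_exp_coeff (Suc k) m - (if m = 0 then 0 else pow_exp_coeff (Suc k) (m - 1))"
    by (rule pow_exp_coeff.simps)
  also have "\<dots> = (real m - real k) * pow_exp_coeff k m - (real m + 1) * pow_exp_coeff k (m + 1)
      - (if m = 0 then 0
         else (real (m - 1) - real k) * pow_exp_coeff k (m - 1) - real m * pow_exp_coeff k m)"
    unfolding Suc.IH by simp
  \<comment> \<open>Regrouping as a product with 1 - x turns k into k + 1, because D(1 - x) =
    -1.\<close>
  also have "\<dots> = (real m - real (Suc k)) * pow_exp_coeff (Suc k) m
      - (real m + 1) * pow_exp_coeff (Suc k) (m + 1)"
    by (cases m) (simp_all add: algebra_simps)
  finally show ?case .
qed

text \<open>The -1 in exp(-x) - 1 affects row 0 only: it sits at \<open>m = 0\<close>, where the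
  recurrence multiplies it by 0.\<close>

lemma degen_B_matrix_1_eq:
  "degen_B_matrix 1 k m = pow_exp_coeff k m - (if k = 0 \<and> m = 0 then 1 else 0)"
proof (induction k arbitrary: m)
  case 0
  show ?case by simp
next
  case (Suc k)
  show ?case
    unfolding degen_B_matrix.simps pow_exp_coeff_Suc_eq Suc.IH by simp
qed

theorem theorem2p7:
  fixes l :: real and n :: nat
  assumes "l \<noteq> 0" and "n \<ge> 1"
  shows "degen_B_matrix l n 0 = (\<Sum>k=1..n. degen_stirling2 l n k)
       \<and> (\<Sum>k=1..n. degen_stirling2 l n k) = degen_bell l n"
proof
  have "degen_B_matrix l n 0 = (\<Sum>k=0..n. degen_stirling2 l n k * (if k = 0 then 0 else 1))"
    unfolding degen_B_matrix_eq_sum[of l n]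
    by (intro sum.cong) (auto simp: degen_B_matrix_1_eq pow_exp_coeff_right_0)
  then show "degen_B_matrix l n 0 = (\<Sum>k=1..n. degen_stirling2 l n k)"
    by (simp add: sum.atLeast_Suc_atMost)
  show "(\<Sum>k=1..n. degen_stirling2 l n k) = degen_bell l n"
    \<comment> \<open>For \<open>n = 0\<close> the term \<open>k = 0\<close> would be 1; from
      \<open>n = 1\<close> on it vanishes.\<close>
    using assms(2) by (simp add: degen_bell_def sum.atLeast_Suc_atMost degen_stirling2_right_0)
qed

end
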